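(* Let $F$ be a field, $n\ge 1$, and $A\in M_n(F)$. Then there exist a lower triangular matrix $L\in M_n(F)$ and an upper triangular matrix $U\in M_n(F)$ with $A=LU$ if and only if for every $k=1,\ldots,n$ $$\operatorname{rank}A[\{1,\ldots,k\}]+k\ \ge\ \operatorname{rank}A[\{1,\ldots,k\},\{1,\ldots,n\}]+\operatorname{rank}A[\{1,\ldots,n\},\{1,\ldots,k\}].$$
   Context: $M_n(F)$ is the set of $n\times n$ matrices over $F$. For index sets $\alpha,\beta$, $A[\alpha,\beta]$ is the submatrix of $A$ with rows indexed by $\alpha$ and columns indexed by $\beta$, and $A[\alpha]=A[\alpha,\alpha]$. The triangular matrices $L$ and $U$ are not required to be invertible and their diagonal entries may be arbitrary (including zero). *)

theory Defs
  imports "Jordan_Normal_Form.DL_Rank_Submatrix"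
begin

text \<open>
  Rows and columns are numbered from 0, so the index set \<open>{1, ..., k}\<close> of the mathematical text
  is \<open>{0..<k}\<close> here.
\<close>

definition lower_triangular :: "'a::zero mat \<Rightarrow> bool" where
  "lower_triangular A \<longleftrightarrow> (\<forall>i < dim_row A. \<forall>j < dim_col A. i < j \<longrightarrow> A $$ (i, j) = 0)"

text \<open>
  \<open>vec_space.rank m B\<close> is the dimension of the column space of \<open>B\<close> in \<open>F^m\<close>; it is meaningful only
  if \<open>m\<close> is the number of rows of \<open>B\<close>.
\<close>
abbreviation mat_rank :: "'a::field mat \<Rightarrow> nat" where
  "mat_rank B \<equiv> vec_space.rank (dim_row B) B"

end

theory Submission
  imports Defs
begin

text \<open>
  A factorisation \<open>A = L * U\<close> writes \<open>A\<close> as a sum of rank one matrices, the \<open>t\<close>-th of which vanishes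
  outside the rows and columns with index at least \<open>t\<close>. Necessity is Sylvester's inequality for the
  leading blocks of \<open>L\<close> and \<open>U\<close>. For sufficiency the summands are split off one at a time: choose a
  nonzero entry \<open>(p, q)\<close> with \<open>min p q\<close>, and then \<open>p + q\<close>, minimal, and subtract the product of
  column \<open>q\<close> and row \<open>p\<close>, divided by this entry. Because column \<open>q\<close> vanishes above \<open>p\<close> and row \<open>p\<close>
  left of \<open>q\<close>, this lowers by one the rank of exactly those leading blocks that contain the entry and
  leaves the others unchanged, so that the rank inequalities survive with one index fewer.
\<close>

section \<open>Rank as the least length of a factorisation\<close>

text \<open>The rank is the size of a maximal independent set of columns; by Steinitz exchange such
  a set is no larger than any finite set spanning it.\<close>

lemma (in vec_space) rank_le_card_spanning:
  assumes "A \<in> carrier_mat n nc" and "finite B" and "B \<subseteq> carrier_vec n"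
    and "set (cols A) \<subseteq> span B"
  shows "rank A \<le> card B"
proof -
  obtain S where S: "maximal S (\<lambda>T. T \<subseteq> set (cols A) \<and> lin_indpt T)"
    using maximal_exists_superset[of "set (cols A)" "\<lambda>T. T \<subseteq> set (cols A) \<and> lin_indpt T" "{}"]
      finite_lin_indpt2[of "{}"] by auto
  then have "S \<subseteq> span B" "lin_indpt S" "finite S"
    using assms(4) finite_subset[of S "set (cols A)"] by (auto simp: maximal_def)
  then obtain C :: "'a vec set" where "int (card C) \<le> int (card B) - int (card S)"
    using replacement[of S B] assms(2,3) by auto
  then show ?thesis
    using rank_card_indpt[OF assms(1) S] by linarith
qed

text \<open>A maximal independent set of columns does it: any further column would make it dependent
  and therefore lies in its span.\<close>

lemma (in vec_space) spanning_cols_card_rank: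
  assumes "A \<in> carrier_mat n nc"
  obtains S where "finite S" "S \<subseteq> carrier_vec n" "card S = rank A" "set (cols A) \<subseteq> span S"
proof -
  obtain S where S: "maximal S (\<lambda>T. T \<subseteq> set (cols A) \<and> lin_indpt T)"
    using maximal_exists_superset[of "set (cols A)" "\<lambda>T. T \<subseteq> set (cols A) \<and> lin_indpt T" "{}"]
      finite_lin_indpt2[of "{}"] by auto
  have cols: "set (cols A) \<subseteq> carrier_vec n"
    using assms cols_dim by blast
  have sub: "S \<subseteq> set (cols A)" and li: "lin_indpt S"
    using S by (auto simp: maximal_def)
  then have fin: "finite S" and carr: "S \<subseteq> carrier_vec n"
    using finite_subset cols by blast+
  have "c \<in> span S" if c: "c \<in> set (cols A)" for c
  proof (cases "c \<in> S")
    case True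
    then show ?thesis using span_mem[OF carr] by blast
  next
    case False
    have "lin_dep (S \<union> {c})"
    proof (rule ccontr)
      assume "lin_indpt (S \<union> {c})"
      then have "S \<union> {c} = S"
        using S c sub unfolding maximal_def by blast
      then show False using False by blast
    qed
    then show ?thesis
      using lin_dep_iff_in_span[of S c] False li carr c cols by auto
  qed
  then show ?thesis
    using that[OF fin carr] rank_card_indpt[OF assms S] by auto
qed

text \<open>
  Arrays \<open>nat \<Rightarrow> nat \<Rightarrow> 'a\<close> stand for matrices of unspecified size, so that passing to an initial block
  only changes the two size arguments of \<open>rk\<close>.
\<close>

definition rk :: "(nat \<Rightarrow> nat \<Rightarrow> 'a::field) \<Rightarrow> nat \<Rightarrow> nat \<Rightarrow> nat" where
  "rk a k l = mat_rank (mat k l (\<lambda>(i, j). a i j))"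

text \<open>Every column of the block is a combination of the \<open>r\<close> vectors formed by the
  \<open>x i t\<close>. Upper bounds on ranks are obtained below by exhibiting such
  factorisations.\<close>

lemma rk_leI:
  fixes a :: "nat \<Rightarrow> nat \<Rightarrow> 'a::field"
  assumes "\<And>i j. i < k \<Longrightarrow> j < l \<Longrightarrow> a i j = (\<Sum>t<r. x i t * y t j)"
  shows "rk a k l \<le> r"
proof -
  interpret vec_space "TYPE('a)" k .
  define B where "B = (\<lambda>t. vec k (\<lambda>i. x i t)) ` {..<r}"
  define A where "A = mat k l (\<lambda>(i, j). a i j)"
  have B: "finite B" "B \<subseteq> carrier_vec k" "card B \<le> r"
    by (auto simp: B_def intro: order.trans[OF card_image_le])
  have comb: "vec k (\<lambda>i. \<Sum>t<s. x i t * c t) \<in> span B" if "s \<le> r" for s c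
    using that
  proof (induction s)
    case 0
    have "vec k (\<lambda>i. \<Sum>t<0. x i t * c t) = 0\<^sub>v k"
      by auto
    then show ?case
      using submodule.zero_closed[OF span_is_submodule[OF B(2)]] by (simp add: module_vec_simps)
  next
    case (Suc s)
    have "vec k (\<lambda>i. x i s) \<in> span B"
      using span_mem[OF B(2)] Suc.prems by (auto simp: B_def)
    then have "c s \<cdot>\<^sub>v vec k (\<lambda>i. x i s) \<in> span B"
      using submodule.smult_closed[OF span_is_submodule[OF B(2)]] by simp
    moreover have "vec k (\<lambda>i. \<Sum>t<s. x i t * c t) \<in> span B"
      using Suc by simp
    ultimately have "vec k (\<lambda>i. \<Sum>t<s. x i t * c t) + c s \<cdot>\<^sub>v vec k (\<lambda>i. x i s) \<in> span B"
      by (rule span_add1[OF B(2), rotated])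
    also have "vec k (\<lambda>i. \<Sum>t<s. x i t * c t) + c s \<cdot>\<^sub>v vec k (\<lambda>i. x i s)
        = vec k (\<lambda>i. \<Sum>t<Suc s. x i t * c t)"
      by (auto simp: mult.commute)
    finally show ?case .
  qed
  have "set (cols A) \<subseteq> span B"
  proof
    fix v assume "v \<in> set (cols A)"
    then obtain j where j: "j < l" "v = col A j"
      by (auto simp: in_set_conv_nth A_def)
    then have "v = vec k (\<lambda>i. \<Sum>t<r. x i t * y t j)"
      using assms by (auto simp: A_def)
    then show "v \<in> span B" using comb[of r] by simp
  qed
  then have "rank A \<le> card B"
    by (intro rank_le_card_spanning[OF _ B(1,2)]) (auto simp: A_def)
  then show ?thesis using B(3) by (simp add: rk_def A_def)
qed

text \<open>Expanding the columns in a spanning set of size equal to the rank gives the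
  factorisation. Together with \<open>rk_leI\<close> this characterises \<open>rk\<close> as the
  least inner dimension, so that later arguments need no vector spaces.\<close>

lemma rk_leE:
  fixes a :: "nat \<Rightarrow> nat \<Rightarrow> 'a::field"
  assumes "rk a k l \<le> r"
  obtains x y where "\<And>i j. i < k \<Longrightarrow> j < l \<Longrightarrow> a i j = (\<Sum>t<r. x i t * y t j)"
proof -
  interpret vec_space "TYPE('a)" k .
  define A where "A = mat k l (\<lambda>(i, j). a i j)"
  obtain S where S: "finite S" "S \<subseteq> carrier_vec k" "card S = rank A" "set (cols A) \<subseteq> span S"
    by (rule spanning_cols_card_rank[of A l]) (auto simp: A_def)
  obtain f where f: "bij_betw f {..<card S} S"
    using ex_bij_betw_nat_finite[OF S(1)] by (auto simp: atLeast0LessThan)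
  have r: "card S \<le> r" using assms S(3) by (simp add: rk_def A_def)
  have "\<exists>c. col A j = lincomb c S" if "j < l" for j
  proof -
    have "col A j \<in> span S"
      using S(4) that by (auto simp: cols_def A_def)
    then obtain c where "lincomb c S = col A j"
      using finite_in_span[OF S(1)] S(2) by (metis carrier_vec_def module_vec_simps(3))
    then show ?thesis by metis
  qed
  then obtain c where c: "\<And>j. j < l \<Longrightarrow> col A j = lincomb (c j) S"
    by metis
  show ?thesis
  proof (rule that)
    fix i j assume ij: "i < k" "j < l"
    have "a i j = lincomb (c j) S $ i"
      using ij by (simp add: c[symmetric] A_def)
    also have "\<dots> = (\<Sum>v\<in>S. v $ i * c j v)"
      using lincomb_index[OF ij(1) S(2)] by (simp add: mult.commute)
    also have "\<dots> = (\<Sum>t<card S. f t $ i * c j (f t))"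
      using sum.reindex_bij_betw[OF f, of "\<lambda>v. v $ i * c j v"] by simp
    \<comment> \<open>The bound \<open>r\<close> may exceed the rank; the surplus terms are padded
      with zeros.\<close>
    also have "\<dots> = (\<Sum>t<r. (if t < card S then f t $ i else 0) * c j (f t))"
      using r by (intro sum.mono_neutral_cong_left) auto
    finally show "a i j = (\<Sum>t<r. (if t < card S then f t $ i else 0) * c j (f t))" .
  qed
qed

section \<open>Ranks of initial blocks\<close>

lemma submatrix_initial:
  assumes "A \<in> carrier_mat n m" and "k \<le> n" and "l \<le> m"
  shows "submatrix A {0..<k} {0..<l} = mat k l (\<lambda>(i, j). A $$ (i, j))"
proof -
  have pick: "pick {0..<s} i = i" if "i < s" for s i
  proof -
    have "{b \<in> {0..<s}. b < i} = {..<i}"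
      using that by auto
    then show ?thesis
      using pick_card_in_set[of i "{0..<s}"] that by simp
  qed
  have "{i. i < n \<and> i \<in> {0..<k}} = {..<k}" "{j. j < m \<and> j \<in> {0..<l}} = {..<l}"
    using assms by auto
  then have "submatrix A {0..<k} {0..<l} = mat k l (\<lambda>(i, j). A $$ (pick {0..<k} i, pick {0..<l} j))"
    using assms(1) by (simp add: submatrix_def)
  also have "\<dots> = mat k l (\<lambda>(i, j). A $$ (i, j))"
    by (rule cong_mat) (simp_all add: pick)
  finally show ?thesis .
qed

lemma rk_cong:
  assumes "\<And>i j. i < k \<Longrightarrow> j < l \<Longrightarrow> a i j = b i j"
  shows "rk a k l = rk b k l"
proof -
  have "mat k l (\<lambda>(i, j). a i j) = mat k l (\<lambda>(i, j). b i j)"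
    using assms by (intro cong_mat) auto
  then show ?thesis by (simp add: rk_def)
qed

text \<open>A form of \<open>rk_leI\<close> with an arbitrary finite index set, convenient for
  disjoint sums and for sets with an element removed.\<close>

lemma rk_le_card:
  fixes a :: "nat \<Rightarrow> nat \<Rightarrow> 'a::field"
  assumes "finite T"
    and "\<And>i j. i < k \<Longrightarrow> j < l \<Longrightarrow> a i j = (\<Sum>t\<in>T. x i t * y t j)"
  shows "rk a k l \<le> card T"
proof -
  obtain f where f: "bij_betw f {..<card T} T"
    using ex_bij_betw_nat_finite[OF assms(1)] by (auto simp: atLeast0LessThan)
  show ?thesis
    by (rule rk_leI[where x = "\<lambda>i t. x i (f t)" and y = "\<lambda>t. y (f t)"])
      (simp add: assms(2) sum.reindex_bij_betw[OF f, symmetric])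
qed

lemma rk_eq_0_iff: "rk a k l = 0 \<longleftrightarrow> (\<forall>i<k. \<forall>j<l. a i j = 0)"
proof
  assume "rk a k l = 0"
  then obtain x y where "\<And>i j. i < k \<Longrightarrow> j < l \<Longrightarrow> a i j = (\<Sum>t<0::nat. x i t * y t j)"
    by (rule rk_leE[OF eq_imp_le]) blast
  then show "\<forall>i<k. \<forall>j<l. a i j = 0" by simp
next
  assume "\<forall>i<k. \<forall>j<l. a i j = 0"
  then show "rk a k l = 0"
    using rk_leI[where r = 0 and k = k and l = l and a = a] by simp
qed

text \<open>Factor \<open>x\<close> with inner dimension \<open>rk x k m\<close>; by associativity
  the product factors with the same inner dimension.\<close>

lemma rk_mult_le_left: "rk (\<lambda>i j. \<Sum>t<m. x i t * y t j) k l \<le> rk x k m"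
proof -
  obtain p q where x: "\<And>i t. i < k \<Longrightarrow> t < m \<Longrightarrow> x i t = (\<Sum>u<rk x k m. p i u * q u t)"
    using rk_leE[OF order_refl] by blast
  show ?thesis
  proof (rule rk_leI)
    fix i j assume "i < k" "j < l"
    have "(\<Sum>t<m. x i t * y t j) = (\<Sum>t<m. \<Sum>u<rk x k m. p i u * q u t * y t j)"
      using \<open>i < k\<close> by (simp add: x sum_distrib_right)
    also have "\<dots> = (\<Sum>u<rk x k m. p i u * (\<Sum>t<m. q u t * y t j))"
      by (subst sum.swap) (simp add: sum_distrib_left mult.assoc)
    finally show "(\<Sum>t<m. x i t * y t j) = (\<Sum>u<rk x k m. p i u * (\<Sum>t<m. q u t * y t j))" .
  qed
qed

lemma rk_mult_le_right: "rk (\<lambda>i j. \<Sum>t<m. x i t * y t j) k l \<le> rk y m l"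
proof -
  obtain p q where y: "\<And>t j. t < m \<Longrightarrow> j < l \<Longrightarrow> y t j = (\<Sum>u<rk y m l. p t u * q u j)"
    using rk_leE[OF order_refl] by blast
  show ?thesis
  proof (rule rk_leI)
    fix i j assume "i < k" "j < l"
    have "(\<Sum>t<m. x i t * y t j) = (\<Sum>t<m. \<Sum>u<rk y m l. x i t * p t u * q u j)"
      using \<open>j < l\<close> by (simp add: y sum_distrib_left mult.assoc)
    also have "\<dots> = (\<Sum>u<rk y m l. (\<Sum>t<m. x i t * p t u) * q u j)"
      by (subst sum.swap) (simp add: sum_distrib_right)
    finally show "(\<Sum>t<m. x i t * y t j) = (\<Sum>u<rk y m l. (\<Sum>t<m. x i t * p t u) * q u j)" .
  qed
qed

section \<open>Dual systems and Sylvester's inequality\<close>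

text \<open>\<open>I\<close> selects a basis of the row space of \<open>y\<close>, and the vectors
  \<open>z\<close> are dual to it, so the coefficients of any row in this basis are its pairings
  with \<open>z\<close>. Rows are added one at a time; a new row joins the basis exactly when its
  residual \<open>w\<close> is nonzero.\<close>

lemma exists_dual_system:
  fixes y :: "'b \<Rightarrow> nat \<Rightarrow> 'a::field"
  assumes "finite T"
  shows "\<exists>I z. I \<subseteq> T \<and> (\<forall>s\<in>I. \<forall>t\<in>I. (\<Sum>i<l. y s i * z i t) = of_bool (s = t)) \<and>
    (\<forall>t\<in>T. \<forall>j<l. y t j = (\<Sum>s\<in>I. (\<Sum>i<l. y t i * z i s) * y s j))"
  using assms
proof (induction T)
  case empty
  then show ?case by auto
next
  case (insert t0 T)
  then obtain I z where I: "I \<subseteq> T"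
    and dual: "\<And>s t. s \<in> I \<Longrightarrow> t \<in> I \<Longrightarrow> (\<Sum>i<l. y s i * z i t) = of_bool (s = t)"
    and span: "\<And>t j. t \<in> T \<Longrightarrow> j < l \<Longrightarrow> y t j = (\<Sum>s\<in>I. (\<Sum>i<l. y t i * z i s) * y s j)"
    by blast
  have fin: "finite I" and t0: "t0 \<notin> I"
    using I insert.hyps finite_subset by blast+
  define d where "d s = (\<Sum>i<l. y t0 i * z i s)" for s
  define w where "w j = y t0 j - (\<Sum>s\<in>I. d s * y s j)" for j
  show ?case
  proof (cases "\<forall>j<l. w j = 0")
    case True
    then have "y t0 j = (\<Sum>s\<in>I. (\<Sum>i<l. y t0 i * z i s) * y s j)" if "j < l" for j
    proof -
      have "w j = 0" using True that by simp
      then show ?thesis by (simp only: w_def d_def right_minus_eq)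
    qed
    then have "\<forall>t\<in>insert t0 T. \<forall>j<l. y t j = (\<Sum>s\<in>I. (\<Sum>i<l. y t i * z i s) * y s j)"
      using span by blast
    then show ?thesis
      using I dual by (intro exI[of _ I] exI[of _ z]) blast
  next
    case False
    then obtain q where q: "q < l" "w q \<noteq> 0" by auto
    \<comment> \<open>The \<open>q\<close>-th unit vector, corrected and scaled so that pairing with
      \<open>v\<close> returns the residual of a row at \<open>q\<close>, divided by
      \<open>w q\<close>: 0 for the old rows and 1 for the new one.\<close>
    define v where "v i = (of_bool (i = q) - (\<Sum>s\<in>I. z i s * y s q)) / w q" for i
    have dot_v: "(\<Sum>i<l. f i * v i) = (f q - (\<Sum>s\<in>I. (\<Sum>i<l. f i * z i s) * y s q)) / w q" for f
    proof -
      have "(\<Sum>i<l. f i * v i) = (\<Sum>i<l. f i * of_bool (i = q) - (\<Sum>s\<in>I. f i * z i s * y s q)) / w q"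
        by (simp add: v_def sum_divide_distrib sum_distrib_left right_diff_distrib mult.assoc)
      also have "\<dots> = ((\<Sum>i<l. f i * of_bool (i = q)) - (\<Sum>i<l. \<Sum>s\<in>I. f i * z i s * y s q)) / w q"
        by (simp add: sum_subtractf)
      also have "(\<Sum>i<l. \<Sum>s\<in>I. f i * z i s * y s q) = (\<Sum>s\<in>I. (\<Sum>i<l. f i * z i s) * y s q)"
        by (subst sum.swap) (simp add: sum_distrib_right)
      also have "(\<Sum>i<l. f i * of_bool (i = q)) = f q"
        using q(1) by (simp add: of_bool_def if_distrib cong: if_cong)
      finally show ?thesis .
    qed
    have v_T: "(\<Sum>i<l. y t i * v i) = 0" if "t \<in> T" for t
      by (simp add: dot_v span[OF that q(1), symmetric])
    have v_t0: "(\<Sum>i<l. y t0 i * v i) = 1"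
      using q by (simp add: dot_v w_def d_def)
    \<comment> \<open>The old dual vectors are corrected by multiples of \<open>v\<close> so as to
      annihilate the new row; their pairings with the old rows do not change.\<close>
    define z' where "z' i s = (if s = t0 then v i else z i s - d s * v i)" for i s
    have z'_t0: "(\<Sum>i<l. y t i * z' i t0) = (\<Sum>i<l. y t i * v i)" for t
      by (simp add: z'_def)
    have z'_I: "(\<Sum>i<l. y t i * z' i s) = (\<Sum>i<l. y t i * z i s) - d s * (\<Sum>i<l. y t i * v i)"
      if "s \<in> I" for s t
    proof -
      have "s \<noteq> t0" using that t0 by auto
      then show ?thesis
        by (simp add: z'_def right_diff_distrib sum_subtractf sum_distrib_left mult_ac)
    qed
    have z'_t0_I: "(\<Sum>i<l. y t0 i * z' i s) = 0" if "s \<in> I" for s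
      using z'_I[OF that] v_t0 by (simp add: d_def)
    have "\<forall>s\<in>insert t0 I. \<forall>t\<in>insert t0 I. (\<Sum>i<l. y s i * z' i t) = of_bool (s = t)"
      using I t0 by (auto simp: z'_t0 z'_I v_T v_t0 dual d_def subset_iff)
    moreover have "y t j = (\<Sum>s\<in>insert t0 I. (\<Sum>i<l. y t i * z' i s) * y s j)"
      if "t \<in> insert t0 T" "j < l" for t j
    proof (cases "t = t0")
      case True
      then show ?thesis
        using fin t0 by (simp add: z'_t0 v_t0 z'_t0_I)
    next
      case False
      then have "t \<in> T" using that by simp
      then show ?thesis
        using fin t0 by (simp add: z'_t0 z'_I v_T span[OF _ that(2), symmetric])
    qed
    ultimately show ?thesis
      using I by (intro exI[of _ "insert t0 I"] exI[of _ z']) blast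
  qed
qed

text \<open>Take a row basis \<open>I\<close> of \<open>y\<close> with dual vectors
  \<open>z\<close>. For \<open>t\<close> in \<open>I\<close>, applying the product to the dual
  vector of \<open>t\<close> gives column \<open>t\<close> of \<open>x\<close> plus a combination of
  columns outside \<open>I\<close>. So the columns of \<open>x\<close> are spanned by
  \<open>r\<close> vectors spanning the columns of the product and the \<open>m - card I\<close>
  columns outside \<open>I\<close>, while \<open>rk y m l\<close> is at most
  \<open>card I\<close>.\<close>

lemma sylvester_rank_inequality:
  "rk x k m + rk y m l \<le> rk (\<lambda>i j. \<Sum>t<m. x i t * y t j) k l + m"
proof -
  define a where "a = (\<lambda>i j. \<Sum>t<m. x i t * y t j)"
  define r where "r = rk a k l"
  obtain P Q where PQ: "\<And>i j. i < k \<Longrightarrow> j < l \<Longrightarrow> a i j = (\<Sum>u<r. P i u * Q u j)"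
    using rk_leE[OF order_refl] unfolding r_def by blast
  obtain I z where I: "I \<subseteq> {..<m}"
    and dual: "\<And>s t. s \<in> I \<Longrightarrow> t \<in> I \<Longrightarrow> (\<Sum>i<l. y s i * z i t) = of_bool (s = t)"
    and span: "\<And>t j. t \<in> {..<m} \<Longrightarrow> j < l \<Longrightarrow> y t j = (\<Sum>s\<in>I. (\<Sum>i<l. y t i * z i s) * y s j)"
    using exists_dual_system[of "{..<m}" y l, OF finite_lessThan] by blast
  have fin: "finite I" using I finite_subset by blast
  define c where "c u t = (\<Sum>j<l. y u j * z j t)" for u t
  have "rk y m l \<le> card I"
    by (rule rk_le_card[OF fin], rule span) simp_all
  moreover have "rk x k m \<le> card ({..<r} <+> ({..<m} - I))"
  \<comment> \<open>The left summand indexes the columns of \<open>P\<close>, the right one the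
    columns of \<open>x\<close> outside \<open>I\<close>.\<close>
  proof (rule rk_le_card[where x = "\<lambda>i. case_sum (P i) (x i)" and
        y = "case_sum (\<lambda>u t. if t \<in> I then \<Sum>j<l. Q u j * z j t else 0)
                      (\<lambda>u t. if t \<in> I then - c u t else of_bool (u = t))"])
    fix i t assume i: "i < k" and t: "t < m"
    show "x i t = (\<Sum>u\<in>{..<r} <+> ({..<m} - I). case_sum (P i) (x i) u *
      case_sum (\<lambda>u t. if t \<in> I then \<Sum>j<l. Q u j * z j t else 0)
               (\<lambda>u t. if t \<in> I then - c u t else of_bool (u = t)) u t)"
    proof (cases "t \<in> I")
      case True
      have "(\<Sum>u<r. P i u * (\<Sum>j<l. Q u j * z j t)) = (\<Sum>j<l. a i j * z j t)"
        by (simp add: PQ i sum_distrib_left sum_distrib_right mult.assoc sum.swap[of _ "{..<l}"])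
      also have "\<dots> = (\<Sum>u<m. x i u * c u t)"
        unfolding a_def c_def
        by (simp add: sum_distrib_left sum_distrib_right mult.assoc sum.swap[of _ "{..<l}"])
      also have "\<dots> = (\<Sum>u\<in>{..<m} - I. x i u * c u t) + (\<Sum>u\<in>I. x i u * c u t)"
        by (rule sum.subset_diff[OF I]) simp
      also have "(\<Sum>u\<in>I. x i u * c u t) = x i t"
        using True fin by (simp add: c_def dual of_bool_def if_distrib cong: if_cong)
      finally show ?thesis
        using True by (simp add: sum.Plus sum_negf)
    next
      case False
      have "x i u * of_bool (u = t) = (if u = t then x i u else 0)" for u
        by simp
      then have "(\<Sum>u\<in>{..<m} - I. x i u * of_bool (u = t)) = x i t"
        using False t by simp
      then show ?thesis
        using False by (simp add: sum.Plus)
    qed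
  qed simp
  moreover have "card ({..<r} <+> ({..<m} - I)) = r + (m - card I)"
    using I fin by (simp add: card_Plus card_Diff_subset)
  moreover have "card I \<le> m"
    using card_mono[OF _ I] by simp
  ultimately show ?thesis
    by (simp add: r_def a_def)
qed

section \<open>Splitting off rank one summands\<close>

text \<open>The Schur complement of the entry \<open>(p, q)\<close>, with row \<open>p\<close> and
  column \<open>q\<close> kept as zeros so that indices do not shift.\<close>

definition rank_one_reduce :: "(nat \<Rightarrow> nat \<Rightarrow> 'a::field) \<Rightarrow> nat \<Rightarrow> nat \<Rightarrow> nat \<Rightarrow> nat \<Rightarrow> 'a" where
  "rank_one_reduce a p q i j = a i j - a i q * a p j / a p q"

text \<open>Wedderburn's rank reduction. Adding the summand back costs at most one; conversely, the
  vanishing of column \<open>q\<close> is a linear relation that shortens a factorisation of the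
  remainder by one term.\<close>

lemma rk_rank_one_reduce:
  assumes "p < k" and "q < l" and pq: "a p q \<noteq> 0"
  shows "rk a k l = Suc (rk (rank_one_reduce a p q) k l)"
proof (rule antisym)
  let ?b = "rank_one_reduce a p q"
  obtain x y where xy: "\<And>i j. i < k \<Longrightarrow> j < l \<Longrightarrow> ?b i j = (\<Sum>t<rk ?b k l. x i t * y t j)"
    using rk_leE[OF order_refl] by blast
  show "rk a k l \<le> Suc (rk ?b k l)"
  proof (rule rk_leI)
    fix i j assume ij: "i < k" "j < l"
    let ?r = "rk ?b k l"
    have "a i j = ?b i j + a i q * (a p j / a p q)"
      by (simp add: rank_one_reduce_def)
    also have "\<dots> = (\<Sum>t<Suc ?r. (if t = ?r then a i q else x i t) *
                       (if t = ?r then a p j / a p q else y t j))"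
      by (simp add: xy[OF ij])
    finally show "a i j = (\<Sum>t<Suc ?r. (if t = ?r then a i q else x i t) *
                       (if t = ?r then a p j / a p q else y t j))" .
  qed
next
  let ?b = "rank_one_reduce a p q"
  define r where "r = rk a k l"
  obtain x y where xy: "\<And>i j. i < k \<Longrightarrow> j < l \<Longrightarrow> a i j = (\<Sum>t<r. x i t * y t j)"
    using rk_leE[OF order_refl] unfolding r_def by blast
  obtain t0 where t0: "t0 < r" "y t0 q \<noteq> 0"
  proof -
    have "\<exists>t<r. y t q \<noteq> 0"
    proof (rule ccontr)
      assume "\<not> (\<exists>t<r. y t q \<noteq> 0)"
      then have "a p q = 0" using xy[OF assms(1,2)] by simp
      then show False using pq by simp
    qed
    then show ?thesis using that by blast
  qed
  define x' where "x' i t = x i t - a i q * x p t / a p q" for i t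
  have b: "?b i j = (\<Sum>t<r. x' i t * y t j)" if "i < k" "j < l" for i j
  proof -
    have "(\<Sum>t<r. x' i t * y t j) = (\<Sum>t<r. x i t * y t j) - (\<Sum>t<r. a i q / a p q * (x p t * y t j))"
      by (simp add: x'_def left_diff_distrib sum_subtractf mult.assoc)
    also have "\<dots> = a i j - a i q / a p q * a p j"
      using xy[OF that] xy[OF assms(1) that(2)] by (simp add: sum_distrib_left)
    finally show ?thesis by (simp add: rank_one_reduce_def)
  qed
  have b_q: "(\<Sum>t<r. x' i t * y t q) = 0" if "i < k" for i
    using b[OF that assms(2)] pq by (simp add: rank_one_reduce_def)
  have "rk ?b k l \<le> card ({..<r} - {t0})"
  proof (rule rk_le_card)
    fix i j assume ij: "i < k" "j < l"
    \<comment> \<open>The subtracted multiples contribute nothing in total, since column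
      \<open>q\<close> of the remainder vanishes, and they make the factor at \<open>t0\<close>
      zero.\<close>
    let ?y = "\<lambda>t j. y t j - y t q / y t0 q * y t0 j"
    have "(\<Sum>t<r. x' i t * ?y t j) =
        (\<Sum>t<r. x' i t * y t j) - (\<Sum>t<r. (x' i t * y t q) * (y t0 j / y t0 q))"
      by (simp add: right_diff_distrib sum_subtractf mult.assoc)
    also have "\<dots> = ?b i j - (\<Sum>t<r. x' i t * y t q) * (y t0 j / y t0 q)"
      by (simp only: b[OF ij] sum_distrib_right)
    also have "\<dots> = ?b i j"
      by (simp add: b_q[OF ij(1)])
    finally have "?b i j = (\<Sum>t<r. x' i t * ?y t j)" by simp
    also have "\<dots> = (\<Sum>t\<in>{..<r} - {t0}. x' i t * ?y t j)"
      using t0 by (subst sum.remove[of _ t0]) auto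
    finally show "?b i j = (\<Sum>t\<in>{..<r} - {t0}. x' i t * ?y t j)" .
  qed simp
  then show "Suc (rk ?b k l) \<le> rk a k l"
    using t0 by (simp add: r_def)
qed

lemma exists_pivot:
  fixes a :: "nat \<Rightarrow> nat \<Rightarrow> 'a::zero"
  assumes "i0 < n" "j0 < n" "a i0 j0 \<noteq> 0"
  obtains p q where "p < n" "q < n" "a p q \<noteq> 0"
    "\<And>i. i < p \<Longrightarrow> a i q = 0" "\<And>j. j < q \<Longrightarrow> a p j = 0"
    "\<And>i j. i < n \<Longrightarrow> j < n \<Longrightarrow> i < min p q \<or> j < min p q \<Longrightarrow> a i j = 0"
proof -
  \<comment> \<open>Since \<open>i + j < 2 * n\<close> for indices below \<open>n\<close>, this
    weight orders positions lexicographically by \<open>min i j\<close> and then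
    \<open>i + j\<close>.\<close>
  define \<mu> where "\<mu> = (\<lambda>(i, j). min i j * (2 * n) + (i + j))"
  obtain p q where pq: "p < n" "q < n" "a p q \<noteq> 0"
    and least: "\<And>i j. i < n \<Longrightarrow> j < n \<Longrightarrow> a i j \<noteq> 0 \<Longrightarrow> \<mu> (p, q) \<le> \<mu> (i, j)"
    using ex_has_least_nat[of "\<lambda>(i, j). i < n \<and> j < n \<and> a i j \<noteq> 0" "(i0, j0)" \<mu>] assms
    by auto
  have lt1: "\<mu> (i, j) < \<mu> (p, q)" if "min i j \<le> min p q" "i + j < p + q" for i j
    using mult_le_mono1[OF that(1), of "2 * n"] that(2) unfolding \<mu>_def prod.case by linarith
  have lt2: "\<mu> (i, j) < \<mu> (p, q)" if "min i j < min p q" "i < n" "j < n" for i j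
    using mult_le_mono1[of "Suc (min i j)" "min p q" "2 * n"] that
    unfolding \<mu>_def prod.case mult_Suc by linarith
  show ?thesis
  proof (rule that[OF pq])
    show "a i q = 0" if "i < p" for i
      using least[of i q] lt1[of i q] that pq by fastforce
    show "a p j = 0" if "j < q" for j
      using least[of p j] lt1[of p j] that pq by fastforce
    show "a i j = 0" if "i < n" "j < n" "i < min p q \<or> j < min p q" for i j
      using least[of i j] lt2[of i j] that by fastforce
  qed
qed

text \<open>
  After \<open>s\<close> summands have been split off, the remainder lives on the indices from \<open>s\<close> on, hence the
  slack \<open>k - s\<close> in place of \<open>k\<close>.
\<close>

lemma exists_triangular_decomposition:
  fixes a :: "nat \<Rightarrow> nat \<Rightarrow> 'a::field"
  assumes "s \<le> n"
    and "\<And>i j. i < n \<Longrightarrow> j < n \<Longrightarrow> i < s \<or> j < s \<Longrightarrow> a i j = 0"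
    and "\<And>k. s < k \<Longrightarrow> k \<le> n \<Longrightarrow> rk a k n + rk a n k \<le> rk a k k + (k - s)"
  shows "\<exists>x y. (\<forall>i<n. \<forall>j<n. a i j = (\<Sum>t\<in>{s..<n}. x i t * y t j)) \<and>
    (\<forall>i<n. \<forall>t. i < t \<longrightarrow> x i t = 0) \<and> (\<forall>t. \<forall>j<n. j < t \<longrightarrow> y t j = 0)"
  using assms
proof (induction "n - s" arbitrary: a s)
  case 0
  then show ?case
    by (intro exI[of _ "\<lambda>_ _. 0"]) auto
next
  case (Suc h)
  note zero = Suc.prems(2) and ineq = Suc.prems(3)
  have sn: "s < n" using Suc.hyps(2) by simp
  show ?case
  proof (cases "\<forall>i<n. \<forall>j<n. a i j = 0")
    case True
    then show ?thesis
      by (intro exI[of _ "\<lambda>_ _. 0"]) auto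
  next
    case False
    then obtain i0 j0 where "i0 < n" "j0 < n" "a i0 j0 \<noteq> 0" by blast
    then obtain p q where pq: "p < n" "q < n" "a p q \<noteq> 0"
      and col: "\<And>i. i < p \<Longrightarrow> a i q = 0" and row: "\<And>j. j < q \<Longrightarrow> a p j = 0"
      and outer: "\<And>i j. i < n \<Longrightarrow> j < n \<Longrightarrow> i < min p q \<or> j < min p q \<Longrightarrow> a i j = 0"
      by (rule exists_pivot) blast
    define b where "b = rank_one_reduce a p q"
    have b: "b i j = a i j - a i q * a p j / a p q" for i j
      by (simp add: b_def rank_one_reduce_def)
    have sp: "s \<le> p" "s \<le> q"
      using zero[OF pq(1,2)] pq(3) by force+
    \<comment> \<open>With the pivot in row \<open>s\<close> right of the diagonal, the corner block
      of size \<open>Suc s\<close> is zero but its row strip is not. The slack for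
      \<open>Suc s\<close> is 1, so the column strip must be zero.\<close>
    have s_row: "a i s = 0" if "p = s" "s < q" "i < n" for i
    proof -
      have "rk a (Suc s) (Suc s) = 0"
        using zero row[of s] that sn by (auto simp: rk_eq_0_iff less_Suc_eq)
      moreover have "rk a (Suc s) n \<noteq> 0"
        using pq that by (auto simp: rk_eq_0_iff)
      ultimately have "rk a n (Suc s) = 0"
        using ineq[of "Suc s"] sn by simp
      then show ?thesis using that by (simp add: rk_eq_0_iff)
    qed
    have s_col: "a s j = 0" if "q = s" "s < p" "j < n" for j
    proof -
      have "rk a (Suc s) (Suc s) = 0"
        using zero col[of s] that sn by (auto simp: rk_eq_0_iff less_Suc_eq)
      moreover have "rk a n (Suc s) \<noteq> 0"
        using pq that by (auto simp: rk_eq_0_iff)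
      ultimately have "rk a (Suc s) n = 0"
        using ineq[of "Suc s"] sn by simp
      then show ?thesis using that by (simp add: rk_eq_0_iff)
    qed
    have b_row: "b p j = 0" and b_col: "b i q = 0" for i j
      using pq(3) by (simp_all add: b)
    have b_outer: "b i j = 0" if "i < n" "j < n" "i < min p q \<or> j < min p q" for i j
      using that outer[of i j] outer[of i q] outer[of p j] pq by (auto simp: b)
    \<comment> \<open>A pivot on the diagonal at \<open>s\<close> clears both row and column
      \<open>s\<close>. If only one of \<open>p\<close>, \<open>q\<close> is \<open>s\<close>, that
      line is cleared and the other vanishes by \<open>s_row\<close> or
      \<open>s_col\<close>.\<close>
    have b_zero: "b i j = 0" if ij: "i < n" "j < n" "i < Suc s \<or> j < Suc s" for i j
    proof -
      consider "s < min p q" | "p = s" "q = s" | "p = s" "s < q" | "q = s" "s < p"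
        using sp by linarith
      then show ?thesis
      proof cases
        case 1
        then show ?thesis using b_outer[of i j] ij by auto
      next
        case 2
        then show ?thesis using b_outer[of i j] b_row[of j] b_col[of i] ij by (auto simp: less_Suc_eq)
      next
        case 3
        then have "b i s = 0" using s_row[of i] row[of s] ij by (simp add: b)
        then show ?thesis using 3 b_outer[of i j] b_row[of j] ij by (auto simp: less_Suc_eq)
      next
        case 4
        then have "b s j = 0" using s_col[of j] col[of s] ij by (simp add: b)
        then show ?thesis using 4 b_outer[of i j] b_col[of i] ij by (auto simp: less_Suc_eq)
      qed
    qed
    have drop: "rk a k l = Suc (rk b k l)" if "p < k" "q < l" for k l
      using rk_rank_one_reduce[of p k q l a] that pq(3) by (simp add: b_def)
    have same_rows: "rk b k l = rk a k l" if "k \<le> p" for k l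
      using that col by (intro rk_cong) (simp add: b)
    have same_cols: "rk b k l = rk a k l" if "l \<le> q" for k l
      using that row by (intro rk_cong) (simp add: b)
    \<comment> \<open>If \<open>k\<close> exceeds both \<open>p\<close> and \<open>q\<close>, all
      three ranks drop by one, matching the loss of one in the slack. If it exceeds only one of
      them, one strip drops and the corner does not. Otherwise both strips of \<open>b\<close> are
      zero.\<close>
    have b_ineq: "rk b k n + rk b n k \<le> rk b k k + (k - Suc s)" if k: "Suc s < k" "k \<le> n" for k
    proof -
      have a_ineq: "rk a k n + rk a n k \<le> rk a k k + (k - s)"
        using ineq[of k] k by simp
      consider "k \<le> p" "k \<le> q" | "p < k" "k \<le> q" | "k \<le> p" "q < k" | "p < k" "q < k"
        by linarith
      then show ?thesis
      proof cases
        case 1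
        then have "rk b k n = 0" "rk b n k = 0"
          using b_outer k by (auto simp: rk_eq_0_iff)
        then show ?thesis by simp
      next
        case 2
        then show ?thesis
          using a_ineq k drop[of k n] same_cols[of k n] same_cols[of k k] pq by simp
      next
        case 3
        then show ?thesis
          using a_ineq k drop[of n k] same_rows[of k n] same_rows[of k k] pq by simp
      next
        case 4
        then show ?thesis
          using a_ineq k drop[of k n] drop[of n k] drop[of k k] pq by simp
      qed
    qed
    have "\<exists>x y. (\<forall>i<n. \<forall>j<n. b i j = (\<Sum>t\<in>{Suc s..<n}. x i t * y t j)) \<and>
        (\<forall>i<n. \<forall>t. i < t \<longrightarrow> x i t = 0) \<and> (\<forall>t. \<forall>j<n. j < t \<longrightarrow> y t j = 0)"
    proof (rule Suc.hyps(1))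
      show "h = n - Suc s" "Suc s \<le> n" using Suc.hyps(2) by simp_all
      show "b i j = 0" if "i < n" "j < n" "i < Suc s \<or> j < Suc s" for i j
        using that by (rule b_zero)
      show "rk b k n + rk b n k \<le> rk b k k + (k - Suc s)" if "Suc s < k" "k \<le> n" for k
        using that by (rule b_ineq)
    qed
    then obtain x y where xy: "\<forall>i<n. \<forall>j<n. b i j = (\<Sum>t\<in>{Suc s..<n}. x i t * y t j)"
      and x: "\<forall>i<n. \<forall>t. i < t \<longrightarrow> x i t = 0" and y: "\<forall>t. \<forall>j<n. j < t \<longrightarrow> y t j = 0"
      by (elim exE conjE)
    show ?thesis
    proof (intro exI conjI allI impI)
      \<comment> \<open>The new summand takes position \<open>s\<close>; it is triangular there
        because column \<open>q\<close> and row \<open>p\<close> vanish before index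
        \<open>s\<close>.\<close>
      let ?x = "\<lambda>i t. if t = s then a i q else x i t"
      let ?y = "\<lambda>t j. if t = s then a p j / a p q else y t j"
      show "a i j = (\<Sum>t\<in>{s..<n}. ?x i t * ?y t j)" if "i < n" "j < n" for i j
      proof -
        have "(\<Sum>t\<in>{s..<n}. ?x i t * ?y t j) = a i q * (a p j / a p q) + b i j"
          using sn by (simp add: sum.atLeast_Suc_lessThan xy[rule_format, OF that])
        then show ?thesis by (simp add: b)
      qed
      show "?x i t = 0" if "i < n" "i < t" for i t
        using that x zero[of i q] pq by auto
      show "?y t j = 0" if "j < n" "j < t" for t j
        using that y zero[of p j] pq by auto
    qed
  qed
qed

section \<open>The factorisation criterion for matrices\<close>

theorem theorem1:
  fixes A :: "'a::field mat" and n :: nat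
  assumes "n \<ge> 1" and "A \<in> carrier_mat n n"
  shows "(\<exists>L U. L \<in> carrier_mat n n \<and> U \<in> carrier_mat n n \<and>
            lower_triangular L \<and> upper_triangular U \<and> A = L * U) \<longleftrightarrow>
         (\<forall>k \<in> {1..n}.
            mat_rank (submatrix A {0..<k} {0..<k}) + k
              \<ge> mat_rank (submatrix A {0..<k} {0..<n}) + mat_rank (submatrix A {0..<n} {0..<k}))"
proof -
  define a where "a = (\<lambda>i j. A $$ (i, j))"
  have rk_A: "mat_rank (submatrix A {0..<k} {0..<l}) = rk a k l" if "k \<le> n" "l \<le> n" for k l
    using submatrix_initial[OF assms(2) that] by (simp add: rk_def a_def)
  have "(\<exists>L U. L \<in> carrier_mat n n \<and> U \<in> carrier_mat n n \<and>
            lower_triangular L \<and> upper_triangular U \<and> A = L * U) \<longleftrightarrow>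
        (\<forall>k \<in> {1..n}. rk a k n + rk a n k \<le> rk a k k + k)"
  proof
    assume "\<exists>L U. L \<in> carrier_mat n n \<and> U \<in> carrier_mat n n \<and>
            lower_triangular L \<and> upper_triangular U \<and> A = L * U"
    then obtain L U where L: "L \<in> carrier_mat n n" "lower_triangular L"
      and U: "U \<in> carrier_mat n n" "upper_triangular U" and A: "A = L * U"
      by blast
    define x y where "x = (\<lambda>i t. L $$ (i, t))" and "y = (\<lambda>t j. U $$ (t, j))"
    \<comment> \<open>Terms with \<open>t \<ge> k\<close> vanish by triangularity of
      \<open>L\<close> if \<open>i < k\<close> and of \<open>U\<close> if \<open>j < k\<close>, so
      the corner and both strips factor through the leading blocks of size \<open>k\<close>.\<close>
    have prod: "a i j = (\<Sum>t<k. x i t * y t j)"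
      if "i < n" "j < n" "i < k \<or> j < k" "k \<le> n" for i j k
    proof -
      have "a i j = (\<Sum>t<n. x i t * y t j)"
        using that L(1) U(1)
        by (simp add: a_def A x_def y_def scalar_prod_def atLeast0LessThan)
      also have "\<dots> = (\<Sum>t<k. x i t * y t j)"
        using that L U
        by (intro sum.mono_neutral_right)
          (auto simp: x_def y_def lower_triangular_def upper_triangular_def)
      finally show ?thesis .
    qed
    show "\<forall>k \<in> {1..n}. rk a k n + rk a n k \<le> rk a k k + k"
    proof
      fix k assume k: "k \<in> {1..n}"
      let ?p = "\<lambda>i j. \<Sum>t<k. x i t * y t j"
      have "rk a k n = rk ?p k n" "rk a n k = rk ?p n k" "rk a k k = rk ?p k k"
        using k by (auto intro!: rk_cong prod)
      \<comment> \<open>The strips have rank at most that of the leading blocks of \<open>L\<close>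
        and \<open>U\<close>, whose product is the corner.\<close>
      then show "rk a k n + rk a n k \<le> rk a k k + k"
        using rk_mult_le_left[of x y k k n] rk_mult_le_right[of x y k n k]
          sylvester_rank_inequality[of x k k y k] by linarith
    qed
  next
    assume ineq: "\<forall>k \<in> {1..n}. rk a k n + rk a n k \<le> rk a k k + k"
    obtain x y where xy: "\<And>i j. i < n \<Longrightarrow> j < n \<Longrightarrow> a i j = (\<Sum>t\<in>{0..<n}. x i t * y t j)"
      and x: "\<And>i t. i < n \<Longrightarrow> i < t \<Longrightarrow> x i t = 0" and y: "\<And>t j. j < n \<Longrightarrow> j < t \<Longrightarrow> y t j = 0"
      using exists_triangular_decomposition[of 0 n a] ineq by auto
    show "\<exists>L U. L \<in> carrier_mat n n \<and> U \<in> carrier_mat n n \<and>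
            lower_triangular L \<and> upper_triangular U \<and> A = L * U"
    proof (intro exI conjI)
      let ?L = "mat n n (\<lambda>(i, t). x i t)" and ?U = "mat n n (\<lambda>(t, j). y t j)"
      show "?L \<in> carrier_mat n n" "?U \<in> carrier_mat n n" by simp_all
      show "lower_triangular ?L" "upper_triangular ?U"
        by (auto simp: lower_triangular_def upper_triangular_def x y)
      show "A = ?L * ?U"
        using assms(2) xy by (intro eq_matI) (auto simp: a_def scalar_prod_def)
    qed
  qed
  then show ?thesis by (simp add: rk_A)
qed

end
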